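(* Let $p \equiv 1 \pmod 6$ be a prime, and let $\chi$ be the multiplicative character of $\mathbf{F}_p$ of order $2$ (the Legendre symbol modulo $p$). Put $$T_3(\chi) = \sum_{x=0}^{p-1} \chi(x)\, e^{i2\pi x^3/p}, \qquad S_3 = \sum_{x=0}^{p-1} e^{i2\pi x^3/p},$$ and let $i^* = 1$ if $p \equiv 1 \pmod 4$ and $i^* = i$ if $p \equiv 3 \pmod 4$. Then $$T_3(\chi) = \begin{cases} i^*\,(S_3^2 - p)\,p^{-1/2} & \text{if } 2 \text{ is a cubic residue modulo } p,\\[4pt] \dfrac{i^*}{2}\left(4p - S_3^2 \pm S_3\,(12p - 3S_3^2)^{1/2}\right)p^{-1/2} & \text{if } 2 \text{ is a cubic nonresidue modulo } p,\end{cases}$$ where in the second case the equality holds for one of the two choices of the sign $\pm$.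
   Context: Here $\chi(0)=0$, $i$ is the imaginary unit with $i^2=-1$, and $p^{-1/2}$ is the reciprocal of the positive square root of $p$. The symbol $i^*$ is written in the paper as $(-1)^{(p-1)^2/8}$, meaning $1$ or $i$ according as $p \equiv 1$ or $3 \pmod 4$. The sum $S_3$ is real, and $(12p-3S_3^2)^{1/2}$ denotes a square root of $12p-3S_3^2$. The sign $\pm$ in the second case is left undetermined (it depends on $p$). *)

theory Defs
  imports "HOL-Analysis.Analysis" "HOL-Number_Theory.Number_Theory"
begin

text \<open>The field with \<open>p\<close> elements is represented by the residues \<open>0, \<dots>, p - 1\<close>;
  its multiplicative character of order 2, extended by 0 at 0, is \<^const>\<open>Legendre\<close>.\<close>

definition cubic_gauss_sum :: "nat \<Rightarrow> complex" where
  "cubic_gauss_sum p = (\<Sum>x<p. exp (\<i> * 2 * of_real pi * of_nat x ^ 3 / of_nat p))"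

definition cubic_gauss_sum_Legendre :: "nat \<Rightarrow> complex" where
  "cubic_gauss_sum_Legendre p =
     (\<Sum>x<p. of_int (Legendre (int x) (int p)) * exp (\<i> * 2 * of_real pi * of_nat x ^ 3 / of_nat p))"

definition i_star :: "nat \<Rightarrow> complex" where
  "i_star p = (if [p = 1] (mod 4) then 1 else \<i>)"

definition cubic_residue :: "nat \<Rightarrow> int \<Rightarrow> bool" where
  "cubic_residue p a \<longleftrightarrow> coprime a (int p) \<and> (\<exists>y. [y ^ 3 = a] (mod int p))"

end

theory Submission
  imports Defs
begin

text \<open>
  Let \<open>\<psi>\<close> be a character of order 3 and \<open>\<eta>\<close> the Legendre symbol modulo \<open>p\<close>. A nonzero residue \<open>y\<close> has
  \<open>1 + \<psi> y + \<psi>\<^sup>2 y\<close> cube roots, and \<open>\<eta> x = \<eta> (x\<^sup>3)\<close>; so collecting the terms with the same cube turns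
  both sums into Gauss sums with the linear argument:
  \<open>S = g(\<psi>) + g(\<psi>\<^sup>2)\<close> and \<open>T = g(\<eta>) + g(\<eta>\<psi>) + g(\<eta>\<psi>\<^sup>2)\<close>.
  Write \<open>A = g(\<psi>)\<close>, \<open>B = g(\<psi>\<^sup>2)\<close>, \<open>w = \<psi> 2\<close>. Then \<open>A B = p\<close>, and the duplication formula
  \<open>\<alpha>(4) g(\<alpha>) g(\<eta>\<alpha>) = g(\<eta>) g(\<alpha>\<^sup>2)\<close> (the quadratic case of the Hasse--Davenport product formula,
  lemma \<open>gauss_sum_duplication\<close>) expresses the mixed Gauss sums by \<open>A\<close> and \<open>B\<close>, which gives
  \<open>p T = g(\<eta>) (p + w B\<^sup>2 + w\<^sup>2 A\<^sup>2)\<close>.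
  The number 2 is a cubic residue iff \<open>w = 1\<close>, and then the bracket is
  \<open>p + (A + B)\<^sup>2 - 2 A B = S\<^sup>2 - p\<close>. Otherwise \<open>1 + w + w\<^sup>2 = 0\<close>, and twice the bracket is
  \<open>4 p - S\<^sup>2 + D S\<close> with \<open>D = (w - w\<^sup>2) (B - A)\<close>; here \<open>D\<^sup>2 = -3 (S\<^sup>2 - 4 p)\<close>, so \<open>D\<close> agrees up
  to sign with the principal square root of \<open>12 p - 3 S\<^sup>2\<close>.

  The overall factor requires the exact value of \<open>g(\<eta>)\<close>, including its sign
  (theorem \<open>quadratic_gauss_sum\<close>). The proof is Gauss's own: the identity
  \<open>\<Sum>k\<le>2m. (-1)\<^sup>k [2m, k]\<^sub>q = \<Prod>j<m. 1 - q\<^bsup>2j+1\<^esup>\<close> between \<open>q\<close>-binomial coefficients, evaluated at a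
  primitive \<open>p\<close>-th root of unity \<open>q\<close> with \<open>p = 2m + 1\<close>, has the quadratic sum on the left and a
  product of sines on the right, both up to explicit \<open>p\<close>-th roots of unity, which cancel; the signs of
  the sines are visible.
\<close>

section \<open>Additive characters and sums over residues\<close>

definition additive_character :: "nat \<Rightarrow> int \<Rightarrow> complex" where
  "additive_character n x = cis (2 * pi * of_int x / of_nat n)"

lemma additive_character_0 [simp]: "additive_character n 0 = 1"
  by (simp add: additive_character_def)

lemma additive_character_add:
  "additive_character n (x + y) = additive_character n x * additive_character n y"
  by (simp add: additive_character_def cis_mult ring_distribs add_divide_distrib)

lemma additive_character_mult_nat:
  "additive_character n (x * int k) = additive_character n x ^ k"
  by (simp add: additive_character_def Complex.DeMoivre mult_ac)

lemma additive_character_minus: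
  "additive_character n (- x) = inverse (additive_character n x)"
  by (simp add: additive_character_def)

lemma additive_character_nonzero [simp]: "additive_character n x \<noteq> 0"
  by (simp add: additive_character_def)

lemma additive_character_eq_1_iff:
  assumes "n > 0"
  shows "additive_character n x = 1 \<longleftrightarrow> int n dvd x"
proof
  assume "additive_character n x = 1"
  then have "exp (\<i> * of_real (2 * pi * of_int x / of_nat n)) = 1"
    by (simp add: additive_character_def cis_conv_exp)
  then obtain k :: int where "2 * pi * of_int x / of_nat n = of_int (2 * k) * pi"
    by (auto simp: exp_eq_1)
  then have "real_of_int x = real_of_int (k * int n)"
    using assms by (simp add: field_simps)
  then show "int n dvd x"
    by (simp only: of_int_eq_iff) simp
next
  assume "int n dvd x"
  then obtain k where "x = int n * k" ..
  then have "2 * pi * of_int x / of_nat n = 2 * pi * of_int k"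
    using assms by simp
  then show "additive_character n x = 1"
    unfolding additive_character_def by (simp only: cis_multiple_2pi Ints_of_int)
qed

lemma additive_character_cong:
  assumes "n > 0" "[x = y] (mod int n)"
  shows "additive_character n x = additive_character n y"
proof -
  have "additive_character n (x - y) = 1"
    using assms by (simp add: additive_character_eq_1_iff cong_iff_dvd_diff)
  then show ?thesis
    using additive_character_add[of n "x - y" y] by simp
qed

lemma additive_character_mod [simp]:
  "additive_character n (x mod int n) = additive_character n x"
  by (cases "n = 0") (auto intro: additive_character_cong)

definition periodic_mod :: "nat \<Rightarrow> (int \<Rightarrow> complex) \<Rightarrow> bool" where
  "periodic_mod n f \<longleftrightarrow> (\<forall>x. f (x mod int n) = f x)"

lemma periodic_mod_cong:
  assumes "periodic_mod n f" "[x = y] (mod int n)"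
  shows "f x = f y"
  using assms unfolding periodic_mod_def cong_def by metis

lemma periodic_mod_additive_character: "periodic_mod n (additive_character n)"
  by (simp add: periodic_mod_def)

lemma periodic_mod_mult:
  "periodic_mod n f \<Longrightarrow> periodic_mod n g \<Longrightarrow> periodic_mod n (\<lambda>x. f x * g x)"
  by (simp add: periodic_mod_def)

text \<open>
  The substitutions behind the laws of Gauss and Jacobi sums are all of this kind: translations,
  scalings by a unit, reflections, and \<open>x \<mapsto> 1 - 2 x\<close>.
\<close>

lemma sum_residues_affine:
  assumes "n > 0" "periodic_mod n f" "coprime a (int n)"
  shows "(\<Sum>x\<in>{0..<int n}. f (a * x + b)) = (\<Sum>x\<in>{0..<int n}. f x)"
proof -
  let ?h = "\<lambda>x. (a * x + b) mod int n"
  have inj: "inj_on ?h {0..<int n}"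
  proof (rule inj_onI)
    fix x y assume xy: "x \<in> {0..<int n}" "y \<in> {0..<int n}" "?h x = ?h y"
    then have "[a * x + b = a * y + b] (mod int n)"
      by (simp add: cong_def)
    then have "[x = y] (mod int n)"
      using assms(3) by (simp add: cong_add_rcancel cong_mult_lcancel)
    with xy show "x = y"
      by (auto intro: cong_less_imp_eq_int)
  qed
  have "?h ` {0..<int n} \<subseteq> {0..<int n}"
    using assms(1) by auto
  then have "?h ` {0..<int n} = {0..<int n}"
    using inj by (intro endo_inj_surj) auto
  with inj have "bij_betw ?h {0..<int n} {0..<int n}"
    by (simp add: bij_betw_def)
  then have "(\<Sum>x\<in>{0..<int n}. f (?h x)) = (\<Sum>x\<in>{0..<int n}. f x)"
    by (rule sum.reindex_bij_betw)
  then show ?thesis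
    using assms(2) by (simp add: periodic_mod_def)
qed

text \<open>
  Translating the summation variable by 1 multiplies the sum by \<open>additive_character n a\<close>; if this
  factor is not 1, the sum must vanish.
\<close>

lemma sum_additive_character:
  assumes "n > 0"
  shows "(\<Sum>x\<in>{0..<int n}. additive_character n (a * x)) = (if int n dvd a then of_nat n else 0)"
proof (cases "int n dvd a")
  case True
  then have "additive_character n (a * x) = 1" for x
    using assms by (simp add: additive_character_eq_1_iff)
  with True show ?thesis by simp
next
  case False
  let ?f = "\<lambda>x. additive_character n (a * x)"
  have per: "periodic_mod n ?f"
    unfolding periodic_mod_def using assms
    by (intro allI additive_character_cong) (simp_all add: cong_def mod_mult_right_eq)
  have "(\<Sum>x\<in>{0..<int n}. ?f x) = (\<Sum>x\<in>{0..<int n}. ?f (1 * x + 1))"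
    using sum_residues_affine[OF assms per, of 1 1] by simp
  also have "\<dots> = additive_character n a * (\<Sum>x\<in>{0..<int n}. ?f x)"
    by (simp add: sum_distrib_left ring_distribs additive_character_add mult_ac)
  finally have "(1 - additive_character n a) * (\<Sum>x\<in>{0..<int n}. ?f x) = 0"
    by (simp add: algebra_simps)
  then show ?thesis
    using False assms by (simp add: additive_character_eq_1_iff)
qed

lemma sum_powers_additive_character:
  assumes "d > 0"
  shows "(\<Sum>i<d. additive_character d a ^ i) = (if int d dvd a then of_nat d else 0)"
proof -
  have "(\<Sum>i<d. additive_character d a ^ i) = (\<Sum>i<d. additive_character d (a * int i))"
    by (simp add: additive_character_mult_nat)
  also have "\<dots> = (\<Sum>x\<in>{0..<int d}. additive_character d (a * x))"
    by (rule sum.reindex_bij_witness[where i = nat and j = int]) auto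
  finally show ?thesis
    using sum_additive_character[OF assms] by simp
qed

section \<open>Multiplicative characters and power residues\<close>

text \<open>
  Characters modulo \<open>p\<close> are functions on all integers, periodic modulo \<open>p\<close> and vanishing exactly on
  the multiples of \<open>p\<close>. In particular the trivial character is 0 at 0, so that products of
  characters are characters again.
\<close>

definition residue_character :: "nat \<Rightarrow> (int \<Rightarrow> complex) \<Rightarrow> bool" where
  "residue_character p \<alpha> \<longleftrightarrow> periodic_mod p \<alpha> \<and> (\<forall>x y. \<alpha> (x * y) = \<alpha> x * \<alpha> y) \<and>
     (\<forall>x. \<alpha> x = 0 \<longleftrightarrow> int p dvd x)"

definition nontrivial_character :: "nat \<Rightarrow> (int \<Rightarrow> complex) \<Rightarrow> bool" where
  "nontrivial_character p \<alpha> \<longleftrightarrow> (\<exists>x. \<not> int p dvd x \<and> \<alpha> x \<noteq> 1)"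

lemma
  assumes "residue_character p \<alpha>"
  shows residue_character_periodic: "periodic_mod p \<alpha>"
    and residue_character_mult: "\<alpha> (x * y) = \<alpha> x * \<alpha> y"
    and residue_character_eq_0_iff: "\<alpha> x = 0 \<longleftrightarrow> int p dvd x"
  using assms by (auto simp: residue_character_def)

lemma residue_character_0: "residue_character p \<alpha> \<Longrightarrow> \<alpha> 0 = 0"
  by (simp add: residue_character_eq_0_iff)

lemma residue_character_1:
  assumes "residue_character p \<alpha>" "p > 1"
  shows "\<alpha> 1 = 1"
  using residue_character_mult[OF assms(1), of 1 1] residue_character_eq_0_iff[OF assms(1), of 1]
    assms(2) by auto

lemma residue_character_power:
  assumes "residue_character p \<alpha>" "p > 1"
  shows "\<alpha> (x ^ k) = \<alpha> x ^ k"
  by (induction k) (simp_all add: residue_character_1[OF assms] residue_character_mult[OF assms(1)])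

lemma residue_character_product:
  assumes "residue_character p \<alpha>" "residue_character p \<beta>"
  shows "residue_character p (\<lambda>x. \<alpha> x * \<beta> x)"
  using assms by (simp add: residue_character_def periodic_mod_mult)

lemma primroot_dlog_exists:
  assumes "prime p" "residue_primroot p g" "\<not> int p dvd x"
  shows "\<exists>k. [x = int (g ^ k)] (mod int p)"
proof -
  have p: "p > 1" using assms(1) by (rule prime_gt_1_nat)
  define r where "r = nat (x mod int p)"
  have r: "int r = x mod int p" using p by (simp add: r_def)
  have "int r < int p" "int r \<noteq> 0"
    unfolding r using assms(3) p by (auto simp: dvd_eq_mod_eq_0)
  then have "r \<in> totatives p"
    using assms(1) by (simp add: totatives_prime)
  then obtain k where "r = g ^ k mod p"
    using residue_primroot_is_generator[OF p assms(2)] by (auto simp: bij_betw_def)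
  then have "x mod int p = int (g ^ k) mod int p"
    using r by (simp add: zmod_int)
  then show ?thesis by (auto simp: cong_def)
qed

lemma sum_nonzero_residues_primroot:
  assumes "prime p" "residue_primroot p g" "periodic_mod p f"
  shows "(\<Sum>x\<in>{1..<int p}. f x) = (\<Sum>k<p-1. f (int (g ^ k)))"
proof -
  have p: "p > 1" using assms(1) by (rule prime_gt_1_nat)
  have "(\<Sum>x\<in>{1..<int p}. f x) = (\<Sum>r\<in>{0<..<p}. f (int r))"
    by (rule sum.reindex_bij_witness[where i = int and j = nat]) auto
  also have "\<dots> = (\<Sum>k<p-1. f (int (g ^ k mod p)))"
    using sum.reindex_bij_betw[OF residue_primroot_is_generator[OF p assms(2)], of "\<lambda>r. f (int r)"]
    by (simp add: assms(1) totatives_prime totient_prime)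
  also have "\<dots> = (\<Sum>k<p-1. f (int (g ^ k)))"
    using assms(3) by (simp add: periodic_mod_def zmod_int)
  finally show ?thesis .
qed

text \<open>
  On exponents of a primitive root, \<open>x \<mapsto> x\<^sup>d\<close> is multiplication by \<open>d\<close> modulo \<open>d n = p - 1\<close>. It hits
  precisely the multiples of \<open>d\<close>, each of them \<open>d\<close> times: \<open>F (d k)\<close> depends only on \<open>k\<close> modulo \<open>n\<close>, so
  the left-hand side consists of \<open>d\<close> equal blocks of length \<open>n\<close>.
\<close>

lemma sum_over_multiples:
  fixes F :: "nat \<Rightarrow> 'a::semiring_1"
  assumes "d > 0" and "\<And>k. F (k + d * n) = F k"
  shows "(\<Sum>k<d*n. F (d * k)) = (\<Sum>k<d*n. if d dvd k then of_nat d * F k else 0)"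
proof -
  have F_shift: "F (d * (j + m * n)) = F (d * j)" for j m
  proof (induction m)
    case (Suc m)
    then show ?case
      using assms(2)[of "d * (j + m * n)"] by (simp add: algebra_simps)
  qed simp
  have "(\<Sum>k<d*n. F (d * k)) = (\<Sum>m<d. \<Sum>k\<in>{m*n..<m*n+n}. F (d * k))"
    by (rule sum.nat_group[symmetric])
  also have "\<dots> = (\<Sum>m<d. \<Sum>j<n. F (d * (j + m * n)))"
  proof (rule sum.cong[OF refl])
    fix m
    show "(\<Sum>k\<in>{m*n..<m*n+n}. F (d * k)) = (\<Sum>j<n. F (d * (j + m * n)))"
      using sum.shift_bounds_nat_ivl[of "\<lambda>k. F (d * k)" 0 "m * n" n]
      by (simp only: atLeast0LessThan add.commute[of n] add_0)
  qed
  also have "\<dots> = (\<Sum>j<n. of_nat d * F (d * j))"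
    by (simp add: F_shift sum_distrib_left)
  also have "\<dots> = (\<Sum>j<n. \<Sum>k\<in>{j*d..<j*d+d}. if d dvd k then of_nat d * F k else 0)"
  proof (rule sum.cong[OF refl])
    fix j
    have "d dvd k \<longleftrightarrow> k = j * d" if "k \<in> {j*d..<j*d+d}" for k
    proof
      assume "d dvd k"
      then obtain c where c: "k = d * c" ..
      with that have "d * j \<le> d * c" "d * c < d * (j + 1)"
        by (simp_all add: algebra_simps)
      then have "j \<le> c" "c < j + 1" using assms(1) by (simp_all only: mult_le_cancel1 mult_less_cancel1)
      with c show "k = j * d" by simp
    qed simp
    then have "(\<Sum>k\<in>{j*d..<j*d+d}. if d dvd k then of_nat d * F k else 0) =
               (\<Sum>k\<in>{j*d..<j*d+d}. if k = j * d then of_nat d * F k else 0)"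
      by (intro sum.cong) auto
    also have "\<dots> = of_nat d * F (d * j)"
      using assms(1) by (simp add: sum.delta mult.commute)
    finally show "of_nat d * F (d * j) =
        (\<Sum>k\<in>{j*d..<j*d+d}. if d dvd k then of_nat d * F k else 0)" ..
  qed
  also have "\<dots> = (\<Sum>k<n*d. if d dvd k then of_nat d * F k else 0)"
    by (rule sum.nat_group)
  finally show ?thesis by (simp add: mult.commute)
qed

lemma primroot_power_cong_iff:
  assumes "prime p" "residue_primroot p g"
  shows "[int (g ^ k) = int (g ^ l)] (mod int p) \<longleftrightarrow> [k = l] (mod (p - 1))"
  using assms order_divides_expdiff[of p g k l]
  by (simp only: cong_int_iff residue_primroot_def totient_prime)

text \<open>
  The last clause says that a unit \<open>a\<close> has \<open>\<Sum>i<d. \<alpha> a ^ i\<close> many \<open>d\<close>-th roots, phrased as a summation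
  rule since this is how it is applied. It excludes characters whose order is a proper divisor of
  \<open>d\<close>, as one sees for \<open>f = 1\<close>.
\<close>

definition power_residue_character :: "nat \<Rightarrow> nat \<Rightarrow> (int \<Rightarrow> complex) \<Rightarrow> bool" where
  "power_residue_character p d \<alpha> \<longleftrightarrow> residue_character p \<alpha> \<and>
     (\<forall>x. \<not> int p dvd x \<longrightarrow> \<alpha> x ^ d = 1) \<and>
     (\<forall>f. periodic_mod p f \<longrightarrow> (\<Sum>x\<in>{1..<int p}. f (x ^ d)) =
        (\<Sum>x\<in>{1..<int p}. f x * (\<Sum>i<d. \<alpha> x ^ i)))"

text \<open>
  With a primitive root \<open>g\<close>, the character sends \<open>g\<^sup>k\<close> to the \<open>k\<close>-th power of a primitive \<open>d\<close>-th root
  of unity. This is well defined because \<open>k\<close> is determined modulo \<open>p - 1\<close>, hence modulo \<open>d\<close>. The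
  sum of the powers \<open>\<alpha> (g\<^sup>k) ^ i\<close> is \<open>d\<close> or 0 according to whether \<open>d\<close> divides \<open>k\<close>.
\<close>

lemma power_residue_character_exists:
  assumes "prime p" "d > 0" "d dvd p - 1"
  shows "\<exists>\<alpha>. power_residue_character p d \<alpha>"
proof -
  have p: "p > 1" using assms(1) by (rule prime_gt_1_nat)
  obtain g where g: "residue_primroot p g"
    using prime_primitive_root_exists[OF p assms(1)] by blast
  have g_ndvd: "\<not> int p dvd int (g ^ k)" for k
  proof -
    have "coprime p (g ^ k)" using g by (simp add: residue_primroot_def)
    then have "\<not> p dvd g ^ k"
      using coprime_common_divisor_nat[of p "g ^ k" p] p by force
    then show ?thesis by (simp only: int_dvd_int_iff not_False_eq_True)
  qed
  define dlog where "dlog x = (SOME k. [x = int (g ^ k)] (mod int p))" for x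
  have dlog: "[x = int (g ^ dlog x)] (mod int p)" if "\<not> int p dvd x" for x
    unfolding dlog_def using primroot_dlog_exists[OF assms(1) g that] by (rule someI_ex)
  define \<alpha> where "\<alpha> x = (if int p dvd x then 0 else additive_character d (int (dlog x)))" for x
  have \<alpha>_eq: "\<alpha> x = additive_character d (int k)" if "[x = int (g ^ k)] (mod int p)" for x k
  proof -
    have nd: "\<not> int p dvd x"
      using cong_dvd_iff[OF that] g_ndvd by simp
    have "[int (g ^ dlog x) = int (g ^ k)] (mod int p)"
      using dlog[OF nd] that cong_trans cong_sym by blast
    then have "[dlog x = k] (mod (p - 1))"
      using primroot_power_cong_iff[OF assms(1) g] by simp
    then have "[dlog x = k] (mod d)"
      using assms(3) by (rule cong_dvd_modulus_nat)
    then have "[int (dlog x) = int k] (mod int d)"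
      by (simp add: cong_int_iff)
    then show ?thesis
      using nd assms(2) by (simp add: \<alpha>_def additive_character_cong)
  qed
  have periodic: "periodic_mod p \<alpha>"
    unfolding periodic_mod_def
  proof
    fix x
    show "\<alpha> (x mod int p) = \<alpha> x"
    proof (cases "int p dvd x")
      case False
      then have "[x mod int p = int (g ^ dlog x)] (mod int p)"
        using dlog by simp
      then show ?thesis using \<alpha>_eq dlog[OF False] by metis
    qed (simp add: \<alpha>_def)
  qed
  have mult: "\<alpha> (x * y) = \<alpha> x * \<alpha> y" for x y
  proof (cases "int p dvd x \<or> int p dvd y")
    case True
    then show ?thesis by (auto simp: \<alpha>_def)
  next
    case False
    then have "[x * y = int (g ^ (dlog x + dlog y))] (mod int p)"
      using cong_mult[OF dlog dlog] by (simp add: power_add)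
    from \<alpha>_eq[OF this] show ?thesis
      using False by (simp add: \<alpha>_def[of x] \<alpha>_def[of y] additive_character_add)
  qed
  have char: "residue_character p \<alpha>"
    using periodic mult by (simp add: residue_character_def) (simp add: \<alpha>_def)
  have \<alpha>_power: "\<alpha> x ^ d = 1" if "\<not> int p dvd x" for x
    using that assms(2) by (simp add: \<alpha>_def additive_character_mult_nat[symmetric] additive_character_eq_1_iff)
  have power_sum: "(\<Sum>x\<in>{1..<int p}. f (x ^ d)) =
            (\<Sum>x\<in>{1..<int p}. f x * (\<Sum>i<d. \<alpha> x ^ i))" if f: "periodic_mod p f" for f
  proof -
    obtain n where n: "p - 1 = d * n" using assms(3) ..
    have fd: "periodic_mod p (\<lambda>x. f (x ^ d))"
      unfolding periodic_mod_def
      by (intro allI periodic_mod_cong[OF f] cong_pow) simp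
    have f\<alpha>: "periodic_mod p (\<lambda>x. f x * (\<Sum>i<d. \<alpha> x ^ i))"
      using f periodic by (simp add: periodic_mod_def)
    have f_shift: "f (int (g ^ (k + d * n))) = f (int (g ^ k))" for k
      by (intro periodic_mod_cong[OF f])
         (simp only: primroot_power_cong_iff[OF assms(1) g] n, simp add: cong_def)
    have "(\<Sum>x\<in>{1..<int p}. f (x ^ d)) = (\<Sum>k<d*n. f (int (g ^ (d * k))))"
      unfolding sum_nonzero_residues_primroot[OF assms(1) g fd] n
      by (simp add: power_mult[symmetric] mult.commute)
    also have "\<dots> = (\<Sum>k<d*n. if d dvd k then of_nat d * f (int (g ^ k)) else 0)"
      using sum_over_multiples[of d "\<lambda>k. f (int (g ^ k))" n, OF assms(2) f_shift] .
    also have "\<dots> = (\<Sum>k<d*n. f (int (g ^ k)) * (\<Sum>i<d. \<alpha> (int (g ^ k)) ^ i))"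
      using sum_powers_additive_character[OF assms(2)]
      by (intro sum.cong) (simp_all add: \<alpha>_eq[OF cong_refl] del: of_nat_power)
    also have "\<dots> = (\<Sum>x\<in>{1..<int p}. f x * (\<Sum>i<d. \<alpha> x ^ i))"
      unfolding sum_nonzero_residues_primroot[OF assms(1) g f\<alpha>] n ..
    finally show ?thesis .
  qed
  show ?thesis
    unfolding power_residue_character_def
  proof (intro exI[of _ \<alpha>] conjI allI impI)
    fix f assume "periodic_mod p f"
    from power_sum[OF this] show "(\<Sum>x\<in>{1..<int p}. f (x ^ d)) =
        (\<Sum>x\<in>{1..<int p}. f x * (\<Sum>i<d. \<alpha> x ^ i))" .
  qed (simp_all add: char \<alpha>_power)
qed

lemma
  assumes "power_residue_character p d \<alpha>"
  shows power_residue_character_character: "residue_character p \<alpha>"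
    and power_residue_character_power: "\<not> int p dvd x \<Longrightarrow> \<alpha> x ^ d = 1"
    and power_residue_character_power_sum: "periodic_mod p f \<Longrightarrow>
      (\<Sum>x\<in>{1..<int p}. f (x ^ d)) = (\<Sum>x\<in>{1..<int p}. f x * (\<Sum>i<d. \<alpha> x ^ i))"
proof -
  note def = assms[unfolded power_residue_character_def]
  from def show "residue_character p \<alpha>" ..
  from def show "\<alpha> x ^ d = 1" if "\<not> int p dvd x" using that by simp
  from def[THEN conjunct2, THEN conjunct2, THEN spec[of _ f]]
  show "(\<Sum>x\<in>{1..<int p}. f (x ^ d)) = (\<Sum>x\<in>{1..<int p}. f x * (\<Sum>i<d. \<alpha> x ^ i))"
    if "periodic_mod p f" using that by (rule mp)
qed

lemma sum_residues_split_0: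
  fixes f :: "int \<Rightarrow> 'a::comm_monoid_add"
  assumes "p > 0"
  shows "(\<Sum>x\<in>{0..<int p}. f x) = f 0 + (\<Sum>x\<in>{1..<int p}. f x)"
proof -
  have "{0..<int p} = insert 0 {1..<int p}" using assms by auto
  then show ?thesis by simp
qed

text \<open>
  Where the character is 1, the root-counting sum is \<open>d\<close> and not 0; applying the summation rule to
  the indicator function of the residue class of \<open>a\<close> therefore produces a \<open>d\<close>-th root of \<open>a\<close>.
\<close>

lemma power_residue_character_eq_1_iff:
  assumes "prime p" "d > 0" "power_residue_character p d \<alpha>" and a: "\<not> int p dvd a"
  shows "\<alpha> a = 1 \<longleftrightarrow> (\<exists>y. [y ^ d = a] (mod int p))"
proof
  note char = power_residue_character_character[OF assms(3)]
  have p: "p > 1" using assms(1) by (rule prime_gt_1_nat)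
  assume "\<exists>y. [y ^ d = a] (mod int p)"
  then obtain y where y: "[y ^ d = a] (mod int p)" ..
  have "\<not> int p dvd y ^ d"
    using cong_dvd_iff[OF y] a by simp
  then have "\<not> int p dvd y"
    using dvd_trans[OF _ dvd_power[of d y]] assms(2) by blast
  then show "\<alpha> a = 1"
    using periodic_mod_cong[OF residue_character_periodic[OF char] y]
      residue_character_power[OF char p] power_residue_character_power[OF assms(3)] by simp
next
  note char = power_residue_character_character[OF assms(3)]
  have p: "p > 1" using assms(1) by (rule prime_gt_1_nat)
  assume "\<alpha> a = 1"
  define f :: "int \<Rightarrow> complex" where "f x = (if [x = a] (mod int p) then 1 else 0)" for x
  have f: "periodic_mod p f"
    by (simp add: periodic_mod_def f_def)
  let ?b = "a mod int p"
  have b: "?b \<in> {1..<int p}"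
    using p a pos_mod_sign[of "int p" a] pos_mod_bound[of "int p" a]
    unfolding dvd_eq_mod_eq_0 atLeastLessThan_iff by linarith
  have "\<alpha> ?b = 1"
    using residue_character_periodic[OF char] \<open>\<alpha> a = 1\<close> by (simp add: periodic_mod_def)
  have "(\<Sum>x\<in>{1..<int p}. f x * (\<Sum>i<d. \<alpha> x ^ i)) =
        (\<Sum>x\<in>{1..<int p}. if x = ?b then (\<Sum>i<d. \<alpha> x ^ i) else 0)"
    by (intro sum.cong) (auto simp: f_def cong_def)
  also have "\<dots> = of_nat d"
    using b \<open>\<alpha> ?b = 1\<close> by (simp add: sum.delta)
  finally have "(\<Sum>x\<in>{1..<int p}. f (x ^ d)) \<noteq> 0"
    using power_residue_character_power_sum[OF assms(3) f] assms(2) by simp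
  then obtain x where "f (x ^ d) \<noteq> 0"
    using sum.neutral[of "{1..<int p}" "\<lambda>x. f (x ^ d)"] by blast
  then show "\<exists>y. [y ^ d = a] (mod int p)"
    by (auto simp: f_def split: if_splits)
qed

text \<open>
  The power residue character for \<open>d = 2\<close> takes the values \<open>1\<close> and \<open>-1\<close> on units, and \<open>1\<close> exactly at
  the squares. So it is the Legendre symbol, which inherits multiplicativity and the counting of
  square roots.
\<close>

lemma
  assumes "prime p" "p > 2"
  shows residue_character_Legendre:
      "residue_character p (\<lambda>x. of_int (Legendre x (int p)))"
    and sum_squares_Legendre:
      "periodic_mod p f \<Longrightarrow> (\<Sum>x\<in>{0..<int p}. f (x\<^sup>2)) =
         (\<Sum>x\<in>{0..<int p}. f x * (1 + of_int (Legendre x (int p))))"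
proof -
  have "even (p - 1)" using assms prime_odd_nat by auto
  then obtain \<alpha> where \<alpha>: "power_residue_character p 2 \<alpha>"
    using power_residue_character_exists[OF assms(1) pos2] by blast
  note char = power_residue_character_character[OF \<alpha>]
  have \<alpha>_eq: "\<alpha> x = of_int (Legendre x (int p))" for x
  proof (cases "int p dvd x")
    case True
    then show ?thesis
      by (simp add: residue_character_eq_0_iff[OF char] Legendre_def cong_0_iff)
  next
    case False
    have "\<alpha> x = 1 \<longleftrightarrow> QuadRes (int p) x"
      unfolding QuadRes_def
      using power_residue_character_eq_1_iff[OF assms(1) pos2 \<alpha> False] .
    moreover have "\<alpha> x = 1 \<or> \<alpha> x = -1"
      using power_residue_character_power[OF \<alpha> False] by (simp add: power2_eq_1_iff)
    ultimately show ?thesis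
      using False by (auto simp: Legendre_def cong_0_iff)
  qed
  show "residue_character p (\<lambda>x. of_int (Legendre x (int p)))"
    using char by (simp add: \<alpha>_eq[symmetric])
  assume f: "periodic_mod p f"
  have "(\<Sum>i<2. \<alpha> x ^ i) = 1 + \<alpha> x" for x
    by (simp add: lessThan_nat_numeral)
  with power_residue_character_power_sum[OF \<alpha> f] show "(\<Sum>x\<in>{0..<int p}. f (x\<^sup>2)) =
         (\<Sum>x\<in>{0..<int p}. f x * (1 + of_int (Legendre x (int p))))"
    using assms(2) residue_character_0[OF char]
    by (simp add: sum_residues_split_0 \<alpha>_eq[symmetric])
qed

section \<open>Gauss and Jacobi sums\<close>

definition gauss_sum :: "nat \<Rightarrow> (int \<Rightarrow> complex) \<Rightarrow> complex" where
  "gauss_sum p \<alpha> = (\<Sum>x\<in>{0..<int p}. \<alpha> x * additive_character p x)"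

definition jacobi_sum :: "nat \<Rightarrow> (int \<Rightarrow> complex) \<Rightarrow> (int \<Rightarrow> complex) \<Rightarrow> complex" where
  "jacobi_sum p \<alpha> \<beta> = (\<Sum>x\<in>{0..<int p}. \<alpha> x * \<beta> (1 - x))"

lemma coprime_prime_residue:
  assumes "prime p" "x \<in> {1..<int p}"
  shows "coprime x (int p)" "\<not> int p dvd x"
proof -
  show "\<not> int p dvd x"
    using assms(2) zdvd_not_zless[of x "int p"] by simp
  then show "coprime x (int p)"
    using assms(1) prime_imp_coprime[of "int p" x] by (simp add: coprime_commute)
qed

lemma sum_nontrivial_character:
  assumes "prime p" "residue_character p \<alpha>" "nontrivial_character p \<alpha>"
  shows "(\<Sum>x\<in>{0..<int p}. \<alpha> x) = 0"
proof -
  obtain a where a: "\<not> int p dvd a" "\<alpha> a \<noteq> 1"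
    using assms(3) by (auto simp: nontrivial_character_def)
  have p: "p > 0" using assms(1) by (rule prime_gt_0_nat)
  have "coprime a (int p)"
    using a(1) assms(1) prime_imp_coprime[of "int p" a] by (simp add: coprime_commute)
  then have "(\<Sum>x\<in>{0..<int p}. \<alpha> x) = (\<Sum>x\<in>{0..<int p}. \<alpha> (a * x + 0))"
    using sum_residues_affine[OF p residue_character_periodic[OF assms(2)], of a 0] by simp
  also have "\<dots> = \<alpha> a * (\<Sum>x\<in>{0..<int p}. \<alpha> x)"
    by (simp add: residue_character_mult[OF assms(2)] sum_distrib_left)
  finally have "(1 - \<alpha> a) * (\<Sum>x\<in>{0..<int p}. \<alpha> x) = 0"
    by (simp add: algebra_simps)
  with a(2) show ?thesis by simp
qed

lemma periodic_mod_comp: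
  assumes "periodic_mod p f" "\<And>x. [h (x mod int p) = h x] (mod int p)"
  shows "periodic_mod p (\<lambda>x. f (h x))"
  using periodic_mod_cong[OF assms(1) assms(2)] by (simp add: periodic_mod_def)

lemma periodic_mod_minus_left:
  "periodic_mod p f \<Longrightarrow> periodic_mod p (\<lambda>x. f (s - x))"
  by (erule periodic_mod_comp) (simp add: cong_diff)

text \<open>
  Expand the product and collect the pairs \<open>(x, y)\<close> with sum \<open>s\<close>. For a unit \<open>s\<close>, scaling \<open>x\<close> by \<open>s\<close>
  turns the inner sum into a multiple of the Jacobi sum. The inner sum for \<open>s = 0\<close> is a multiple
  of the sum of \<open>\<alpha>\<beta>\<close>, and vanishes as \<open>\<alpha>\<beta>\<close> is nontrivial.
\<close>

lemma gauss_sum_mult: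
  assumes "prime p" "residue_character p \<alpha>" "residue_character p \<beta>"
    and nontrivial: "nontrivial_character p (\<lambda>x. \<alpha> x * \<beta> x)"
  shows "gauss_sum p \<alpha> * gauss_sum p \<beta> = jacobi_sum p \<alpha> \<beta> * gauss_sum p (\<lambda>x. \<alpha> x * \<beta> x)"
proof -
  let ?R = "{0..<int p}" and ?e = "additive_character p"
  have p: "p > 0" using assms(1) by (rule prime_gt_0_nat)
  note per = residue_character_periodic[OF assms(2)] residue_character_periodic[OF assms(3)]
  note mult = residue_character_mult[OF assms(2)] residue_character_mult[OF assms(3)]
  define C where "C s = (\<Sum>x\<in>?R. \<alpha> x * \<beta> (s - x))" for s
  have C_0: "C 0 = 0"
  proof -
    have "C 0 = (\<Sum>x\<in>?R. \<beta> (-1) * (\<alpha> x * \<beta> x))"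
      unfolding C_def
    proof (rule sum.cong[OF refl])
      fix x
      show "\<alpha> x * \<beta> (0 - x) = \<beta> (-1) * (\<alpha> x * \<beta> x)"
        using mult(2)[of "-1" x] by simp
    qed
    also have "\<dots> = 0"
      using sum_nontrivial_character[OF assms(1) residue_character_product[OF assms(2,3)] nontrivial]
      by (simp add: sum_distrib_left[symmetric])
    finally show ?thesis .
  qed
  have C_unit: "C s = \<alpha> s * \<beta> s * jacobi_sum p \<alpha> \<beta>" if "s \<in> {1..<int p}" for s
  proof -
    have "C s = (\<Sum>x\<in>?R. \<alpha> (s * x + 0) * \<beta> (s - (s * x + 0)))"
      unfolding C_def
      by (rule sum_residues_affine[symmetric, OF p periodic_mod_mult[OF per(1) periodic_mod_minus_left[OF per(2)]]
            coprime_prime_residue(1)[OF assms(1) that]])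
    also have "\<dots> = (\<Sum>x\<in>?R. \<alpha> s * \<beta> s * (\<alpha> x * \<beta> (1 - x)))"
    proof (rule sum.cong[OF refl])
      fix x
      have "s - (s * x + 0) = s * (1 - x)" by (simp add: algebra_simps)
      then show "\<alpha> (s * x + 0) * \<beta> (s - (s * x + 0)) = \<alpha> s * \<beta> s * (\<alpha> x * \<beta> (1 - x))"
        by (simp only: mult add_0_right) (simp only: mult_ac)
    qed
    finally show ?thesis by (simp add: jacobi_sum_def sum_distrib_left)
  qed
  have "gauss_sum p \<alpha> * gauss_sum p \<beta> = (\<Sum>x\<in>?R. \<Sum>y\<in>?R. \<alpha> x * ?e x * (\<beta> y * ?e y))"
    by (simp add: gauss_sum_def sum_product)
  also have "\<dots> = (\<Sum>x\<in>?R. \<Sum>s\<in>?R. \<alpha> x * ?e x * (\<beta> (s - x) * ?e (s - x)))"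
  proof (rule sum.cong[OF refl])
    fix x
    have "(\<Sum>y\<in>?R. \<beta> y * ?e y) = (\<Sum>s\<in>?R. \<beta> (s - x) * ?e (s - x))"
      using sum_residues_affine[OF p periodic_mod_mult[OF per(2) periodic_mod_additive_character], of 1 "- x"]
      by simp
    then show "(\<Sum>y\<in>?R. \<alpha> x * ?e x * (\<beta> y * ?e y)) =
        (\<Sum>s\<in>?R. \<alpha> x * ?e x * (\<beta> (s - x) * ?e (s - x)))"
      by (simp only: sum_distrib_left[symmetric])
  qed
  also have "\<dots> = (\<Sum>x\<in>?R. \<Sum>s\<in>?R. \<alpha> x * \<beta> (s - x) * ?e s)"
  proof (intro sum.cong refl)
    fix x s
    have "?e s = ?e x * ?e (s - x)" by (simp flip: additive_character_add)
    then show "\<alpha> x * ?e x * (\<beta> (s - x) * ?e (s - x)) = \<alpha> x * \<beta> (s - x) * ?e s"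
      by simp
  qed
  also have "\<dots> = (\<Sum>s\<in>?R. C s * ?e s)"
    unfolding C_def sum_distrib_right by (rule sum.swap)
  also have "\<dots> = jacobi_sum p \<alpha> \<beta> * gauss_sum p (\<lambda>x. \<alpha> x * \<beta> x)"
    using p by (simp add: gauss_sum_def sum_residues_split_0 C_0 C_unit sum_distrib_left
        residue_character_0[OF assms(2)] mult_ac)
  finally show ?thesis .
qed

text \<open>
  For \<open>y \<noteq> 0\<close> the substitution \<open>x = y u\<close> cancels \<open>\<beta> y\<close> and leaves \<open>\<alpha> u\<close> times \<open>\<Sum>y. e ((1 + u) y)\<close>.
  By orthogonality only \<open>u = -1\<close> contributes, apart from a multiple of \<open>\<Sum>u. \<alpha> u = 0\<close> that comes from
  leaving out \<open>y = 0\<close>.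
\<close>

lemma gauss_sum_mult_inverse_character:
  assumes "prime p" "residue_character p \<alpha>" "residue_character p \<beta>" "nontrivial_character p \<alpha>"
    and inverse: "\<And>x. \<not> int p dvd x \<Longrightarrow> \<alpha> x * \<beta> x = 1"
  shows "gauss_sum p \<alpha> * gauss_sum p \<beta> = \<alpha> (-1) * of_nat p"
proof -
  let ?R = "{0..<int p}" and ?U = "{1..<int p}" and ?e = "additive_character p"
  have p: "p > 0" using assms(1) by (rule prime_gt_0_nat)
  note per = residue_character_periodic[OF assms(2)]
  have 1: "(\<Sum>x\<in>?R. \<alpha> x * ?e x) * (\<beta> y * ?e y) = (\<Sum>u\<in>?R. \<alpha> u * ?e ((1 + u) * y))"
    if "y \<in> ?U" for y
  proof -
    have "(\<Sum>x\<in>?R. \<alpha> x * ?e x) = (\<Sum>u\<in>?R. \<alpha> (y * u + 0) * ?e (y * u + 0))"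
      by (rule sum_residues_affine[symmetric, OF p periodic_mod_mult[OF per periodic_mod_additive_character]
            coprime_prime_residue(1)[OF assms(1) that]])
    also have "\<dots> * (\<beta> y * ?e y) = (\<Sum>u\<in>?R. (\<alpha> y * \<beta> y) * (\<alpha> u * (?e (y * u) * ?e y)))"
      unfolding sum_distrib_right
      by (intro sum.cong refl) (simp add: residue_character_mult[OF assms(2)] mult_ac)
    also have "\<dots> = (\<Sum>u\<in>?R. \<alpha> u * ?e ((1 + u) * y))"
      using inverse[OF coprime_prime_residue(2)[OF assms(1) that]]
      by (simp add: additive_character_add[symmetric] algebra_simps)
    finally show ?thesis .
  qed
  have 2: "(\<Sum>y\<in>?U. ?e ((1 + u) * y)) = (if u = int p - 1 then of_nat p else 0) - 1"
    if "u \<in> ?R" for u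
  proof -
    have "int p dvd 1 + u \<longleftrightarrow> u = int p - 1"
    proof
      assume "int p dvd 1 + u"
      then have "int p \<le> 1 + u" using that by (intro zdvd_imp_le) auto
      then show "u = int p - 1" using that by simp
    qed simp
    then show ?thesis
      using sum_additive_character[OF p, of "1 + u"] sum_residues_split_0[OF p, of "\<lambda>y. ?e ((1 + u) * y)"]
      by (simp add: algebra_simps)
  qed
  have "gauss_sum p \<alpha> * gauss_sum p \<beta> = (\<Sum>y\<in>?U. (\<Sum>x\<in>?R. \<alpha> x * ?e x) * (\<beta> y * ?e y))"
    using sum_residues_split_0[OF p, of "\<lambda>y. \<beta> y * ?e y"] residue_character_0[OF assms(3)]
    by (simp add: gauss_sum_def sum_distrib_left)
  also have "\<dots> = (\<Sum>y\<in>?U. \<Sum>u\<in>?R. \<alpha> u * ?e ((1 + u) * y))"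
    using 1 by simp
  also have "\<dots> = (\<Sum>u\<in>?R. \<alpha> u * (\<Sum>y\<in>?U. ?e ((1 + u) * y)))"
    unfolding sum_distrib_left by (rule sum.swap)
  also have "\<dots> = (\<Sum>u\<in>?R. \<alpha> u * (if u = int p - 1 then of_nat p else 0)) - (\<Sum>u\<in>?R. \<alpha> u)"
    using 2 by (simp add: right_diff_distrib sum_subtractf)
  also have "\<dots> = \<alpha> (int p - 1) * of_nat p"
    using sum_nontrivial_character[OF assms(1,2,4)] p by (simp add: if_distrib sum.delta cong: if_cong)
  also have "\<alpha> (int p - 1) = \<alpha> (-1)"
    by (rule periodic_mod_cong[OF per]) (simp add: cong_iff_dvd_diff)
  finally show ?thesis .
qed

text \<open>
  Since \<open>4 x (1 - x) = 1 - (1 - 2 x)\<^sup>2\<close>, the left-hand side is \<open>\<Sum>u. \<alpha> (1 - u\<^sup>2)\<close>. Counting square roots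
  by \<open>1 + Legendre v p\<close> yields the right-hand side plus the sum of all values of \<open>\<alpha>\<close>, which is 0.
\<close>

lemma jacobi_sum_duplication:
  assumes "prime p" "p > 2" "residue_character p \<alpha>" "nontrivial_character p \<alpha>"
  shows "\<alpha> 4 * jacobi_sum p \<alpha> \<alpha> = jacobi_sum p (\<lambda>x. of_int (Legendre x (int p))) \<alpha>"
proof -
  let ?R = "{0..<int p}"
  have p: "p > 0" using assms(2) by simp
  note per = residue_character_periodic[OF assms(3)]
  have per_sq: "periodic_mod p (\<lambda>u. \<alpha> (1 - u\<^sup>2))"
    by (intro periodic_mod_comp[OF per] cong_diff cong_pow) simp_all
  have "coprime 2 p"
    using assms(1,2) prime_odd_nat[of p] by simp
  then have "coprime (-2) (int p)"
    using coprime_int_iff[of 2 p] by simp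
  then have affine: "(\<Sum>u\<in>?R. \<alpha> (1 - u\<^sup>2)) = (\<Sum>x\<in>?R. \<alpha> (1 - (-2 * x + 1)\<^sup>2))"
    using sum_residues_affine[OF p per_sq, of "-2" 1] by simp
  have "\<alpha> 4 * jacobi_sum p \<alpha> \<alpha> = (\<Sum>x\<in>?R. \<alpha> (4 * (x * (1 - x))))"
    by (simp only: jacobi_sum_def residue_character_mult[OF assms(3)] sum_distrib_left)
  also have "\<dots> = (\<Sum>u\<in>?R. \<alpha> (1 - u\<^sup>2))"
    unfolding affine by (intro sum.cong refl arg_cong[where f = \<alpha>]) (simp add: power2_eq_square algebra_simps)
  also have "\<dots> = (\<Sum>v\<in>?R. \<alpha> (1 - v) * (1 + of_int (Legendre v (int p))))"
    using sum_squares_Legendre[OF assms(1,2) periodic_mod_minus_left[OF per]] .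
  also have "\<dots> = (\<Sum>v\<in>?R. \<alpha> (1 - v)) + jacobi_sum p (\<lambda>x. of_int (Legendre x (int p))) \<alpha>"
    by (simp add: jacobi_sum_def ring_distribs sum.distrib mult.commute)
  also have "(\<Sum>v\<in>?R. \<alpha> (1 - v)) = 0"
    using sum_residues_affine[OF p per, of "-1" 1] sum_nontrivial_character[OF assms(1,3,4)] by simp
  finally show ?thesis by simp
qed

text \<open>
  The quadratic case of the Hasse--Davenport product formula: write \<open>g(\<alpha>)\<^sup>2\<close> and \<open>g(\<eta>) g(\<alpha>)\<close> by
  Jacobi sums and compare these by \<open>jacobi_sum_duplication\<close>.
\<close>

lemma gauss_sum_duplication:
  assumes "prime p" "p > 2" "residue_character p \<alpha>" "nontrivial_character p (\<lambda>x. \<alpha> x * \<alpha> x)"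
    "nontrivial_character p (\<lambda>x. of_int (Legendre x (int p)) * \<alpha> x)"
    "gauss_sum p \<alpha> \<noteq> 0"
  defines "\<eta> \<equiv> \<lambda>x. complex_of_int (Legendre x (int p))"
  shows "\<alpha> 4 * gauss_sum p \<alpha> * gauss_sum p (\<lambda>x. \<eta> x * \<alpha> x) =
     gauss_sum p \<eta> * gauss_sum p (\<lambda>x. \<alpha> x * \<alpha> x)"
proof -
  have nontrivial: "nontrivial_character p \<alpha>"
    using assms(4) by (auto simp: nontrivial_character_def)
  have \<eta>: "residue_character p \<eta>"
    unfolding \<eta>_def by (rule residue_character_Legendre[OF assms(1,2)])
  have "gauss_sum p \<alpha> * (\<alpha> 4 * gauss_sum p \<alpha> * gauss_sum p (\<lambda>x. \<eta> x * \<alpha> x)) =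
     \<alpha> 4 * (gauss_sum p \<alpha> * gauss_sum p \<alpha>) * gauss_sum p (\<lambda>x. \<eta> x * \<alpha> x)"
    by simp
  also have "\<dots> = (\<alpha> 4 * jacobi_sum p \<alpha> \<alpha>) * gauss_sum p (\<lambda>x. \<alpha> x * \<alpha> x) * gauss_sum p (\<lambda>x. \<eta> x * \<alpha> x)"
    by (simp only: gauss_sum_mult[OF assms(1,3,3,4)] mult.assoc)
  also have "\<dots> = (jacobi_sum p \<eta> \<alpha> * gauss_sum p (\<lambda>x. \<eta> x * \<alpha> x)) * gauss_sum p (\<lambda>x. \<alpha> x * \<alpha> x)"
    by (simp add: jacobi_sum_duplication[OF assms(1-3) nontrivial] \<eta>_def)
  also have "jacobi_sum p \<eta> \<alpha> * gauss_sum p (\<lambda>x. \<eta> x * \<alpha> x) = gauss_sum p \<eta> * gauss_sum p \<alpha>"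
    using gauss_sum_mult[OF assms(1) \<eta> assms(3)] assms(5) by (simp add: \<eta>_def)
  finally show ?thesis
    using assms(6) by (simp add: mult.assoc)
qed

section \<open>The sign of the quadratic Gauss sum\<close>

text \<open>
  The \<open>q\<close>-binomial coefficients, defined by a Pascal rule in order to be available for every \<open>q\<close>, in
  particular at roots of unity, where the usual quotient may degenerate.
\<close>

fun gauss_binomial :: "'a::comm_ring_1 \<Rightarrow> nat \<Rightarrow> nat \<Rightarrow> 'a" where
  "gauss_binomial q n 0 = 1"
| "gauss_binomial q 0 (Suc k) = 0"
| "gauss_binomial q (Suc n) (Suc k) = gauss_binomial q n k + q ^ Suc k * gauss_binomial q n (Suc k)"

lemma gauss_binomial_eq_0: "n < k \<Longrightarrow> gauss_binomial q n k = 0"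
  by (induction q n k rule: gauss_binomial.induct) auto

text \<open>
  The second Pascal rule, which weights the other summand.
\<close>

lemma gauss_binomial_Suc_Suc':
  "k \<le> n \<Longrightarrow> gauss_binomial q (Suc n) (Suc k) =
     q ^ (n - k) * gauss_binomial q n k + gauss_binomial q n (Suc k)"
proof (induction n arbitrary: k)
  case 0
  then show ?case by simp
next
  case (Suc n)
  note step = gauss_binomial.simps(3)
  show ?case
  proof (cases k)
    case 0
    have "gauss_binomial q (Suc (Suc n)) 1 = 1 + q * gauss_binomial q (Suc n) 1"
      by simp
    also have "gauss_binomial q (Suc n) 1 = q ^ n + gauss_binomial q n 1"
      using Suc.IH[of 0] by simp
    also have "1 + q * (q ^ n + gauss_binomial q n 1) = q ^ Suc n + gauss_binomial q (Suc n) 1"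
      by (simp add: algebra_simps)
    finally show ?thesis using 0 by simp
  next
    case (Suc j)
    then have j: "j \<le> n" using Suc.prems by simp
    have upper: "q ^ Suc (Suc j) * gauss_binomial q (Suc n) (Suc (Suc j)) =
        q ^ Suc n * gauss_binomial q n (Suc j) + q ^ Suc (Suc j) * gauss_binomial q n (Suc (Suc j))"
    proof (cases "j = n")
      case True
      then show ?thesis by (simp add: gauss_binomial_eq_0)
    next
      case False
      then have "Suc j \<le> n" using j by simp
      moreover from this have "q ^ Suc (Suc j) * q ^ (n - Suc j) = q ^ Suc n"
        by (simp flip: power_add power_Suc)
      ultimately show ?thesis
        using Suc.IH[of "Suc j"] by (simp only: distrib_left mult.assoc[symmetric])
    qed
    have "q ^ (n - j) * q ^ Suc j = q ^ Suc n"
      using j by (simp flip: power_add power_Suc)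
    then have "q ^ (n - j) * gauss_binomial q (Suc n) (Suc j) =
        q ^ (n - j) * gauss_binomial q n j + q ^ Suc n * gauss_binomial q n (Suc j)"
      by (simp only: step distrib_left mult.assoc[symmetric])
    then show ?thesis
      unfolding Suc step[of q "Suc n" "Suc j"] step[of q n "Suc j"] Suc.IH[OF j] upper[unfolded step[of q n "Suc j"]]
      using Suc.IH[OF j] by (simp add: algebra_simps)
  qed
qed

text \<open>
  Both Pascal rules have the same left-hand side; this is the difference of the two.
\<close>

lemma gauss_binomial_ratio:
  assumes "k \<le> n"
  shows "(1 - q ^ Suc k) * gauss_binomial q n (Suc k) = (1 - q ^ (n - k)) * gauss_binomial q n k"
  using gauss_binomial_Suc_Suc'[OF assms, of q] by (simp add: algebra_simps)

text \<open>
  Let \<open>F n\<close> be the alternating sum of the \<open>[n, k]\<^sub>q\<close>. With the auxiliary sum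
  \<open>G n = \<Sum>k\<le>n. (-1)\<^sup>k q\<^sup>k [n, k]\<^sub>q\<close>, the first Pascal rule gives
  \<open>F (n + 1) = G n - F n\<close>, the second one \<open>G (n + 1) = G n - q\<^bsup>n+1\<^esup> F n\<close>, and \<open>G\<close> cancels from the two.
\<close>

lemma alternating_sum_gauss_binomial_step:
  "(\<Sum>k\<le>Suc (Suc n). (-1) ^ k * gauss_binomial q (Suc (Suc n)) k) =
     (1 - q ^ Suc n) * (\<Sum>k\<le>n. (-1) ^ k * gauss_binomial q n k)"
proof -
  define F where "F n = (\<Sum>k\<le>n. (-1) ^ k * gauss_binomial q n k)" for n
  define G where "G n = (\<Sum>k\<le>n. (-1) ^ k * q ^ k * gauss_binomial q n k)" for n
  have F_shift: "(\<Sum>k\<le>n. (-1) ^ k * gauss_binomial q n (Suc k)) = 1 - F n" for n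
  proof -
    have "F n = (\<Sum>k\<le>Suc n. (-1) ^ k * gauss_binomial q n k)"
      by (simp add: F_def gauss_binomial_eq_0)
    then show ?thesis by (simp only: sum.atMost_Suc_shift) (simp add: sum_negf)
  qed
  have G_shift: "(\<Sum>k\<le>n. (-1) ^ k * q ^ Suc k * gauss_binomial q n (Suc k)) = 1 - G n" for n
  proof -
    have "G n = (\<Sum>k\<le>Suc n. (-1) ^ k * q ^ k * gauss_binomial q n k)"
      by (simp add: G_def gauss_binomial_eq_0)
    then show ?thesis by (simp only: sum.atMost_Suc_shift) (simp add: sum_negf)
  qed
  have F_Suc: "F (Suc n) = G n - F n" for n
  proof -
    have "F (Suc n) = 1 - (\<Sum>k\<le>n. (-1) ^ k * gauss_binomial q (Suc n) (Suc k))"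
      unfolding F_def sum.atMost_Suc_shift by (simp add: sum_negf)
    also have "(\<Sum>k\<le>n. (-1) ^ k * gauss_binomial q (Suc n) (Suc k)) =
        F n + (\<Sum>k\<le>n. (-1) ^ k * q ^ Suc k * gauss_binomial q n (Suc k))"
      by (simp add: F_def distrib_left sum.distrib mult.assoc)
    finally show ?thesis by (simp only: G_shift) simp
  qed
  have G_Suc: "G (Suc n) = G n - q ^ Suc n * F n" for n
  proof -
    have "G (Suc n) = 1 - (\<Sum>k\<le>n. (-1) ^ k * q ^ Suc k * gauss_binomial q (Suc n) (Suc k))"
      unfolding G_def sum.atMost_Suc_shift by (simp add: sum_negf)
    also have "(\<Sum>k\<le>n. (-1) ^ k * q ^ Suc k * gauss_binomial q (Suc n) (Suc k)) =
        (\<Sum>k\<le>n. q ^ Suc n * ((-1) ^ k * gauss_binomial q n k) +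
                (-1) ^ k * q ^ Suc k * gauss_binomial q n (Suc k))"
    proof (rule sum.cong[OF refl])
      fix k assume "k \<in> {..n}"
      then have "q ^ Suc k * q ^ (n - k) = q ^ Suc n"
        by (simp flip: power_add power_Suc)
      moreover have "(-1) ^ k * q ^ Suc k * (q ^ (n - k) * c) = q ^ Suc k * q ^ (n - k) * ((-1) ^ k * c)" for c
        by (simp only: mult_ac)
      ultimately have "(-1) ^ k * q ^ Suc k * (q ^ (n - k) * c) = q ^ Suc n * ((-1) ^ k * c)" for c
        by simp
      then show "(-1) ^ k * q ^ Suc k * gauss_binomial q (Suc n) (Suc k) =
          q ^ Suc n * ((-1) ^ k * gauss_binomial q n k) + (-1) ^ k * q ^ Suc k * gauss_binomial q n (Suc k)"
        using \<open>k \<in> {..n}\<close> by (simp only: gauss_binomial_Suc_Suc' atMost_iff distrib_left)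
    qed
    also have "\<dots> = q ^ Suc n * F n + (1 - G n)"
      by (simp only: sum.distrib G_shift F_def sum_distrib_left)
    finally show ?thesis by simp
  qed
  have "F (Suc (Suc n)) = (1 - q ^ Suc n) * F n"
    by (simp add: F_Suc G_Suc algebra_simps)
  then show ?thesis by (simp only: F_def)
qed

lemma alternating_sum_gauss_binomial:
  "(\<Sum>k\<le>2*m. (-1) ^ k * gauss_binomial q (2*m) k) = (\<Prod>j<m. 1 - q ^ (2 * j + 1))"
proof (induction m)
  case (Suc m)
  then show ?case
    using alternating_sum_gauss_binomial_step[of q "2 * m"] by (simp add: mult.commute del: power_Suc)
qed simp

text \<open>
  At a primitive root of unity of order \<open>n + 1\<close>, the ratio of consecutive coefficients is
  \<open>(1 - q\<^bsup>-(k+1)\<^esup>) / (1 - q\<^bsup>k+1\<^esup>) = - q\<^bsup>-(k+1)\<^esup>\<close>. Hence \<open>[n, k]\<^sub>q\<close> is a signed power of \<open>q\<close> with the triangular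
  exponent \<open>- k (k + 1) / 2\<close>; the square root \<open>\<zeta>\<close> of \<open>1 / q\<close> avoids the halving.
\<close>

lemma gauss_binomial_root_of_unity:
  fixes q \<zeta> :: complex
  assumes "q ^ Suc n = 1" "\<And>k. 0 < k \<Longrightarrow> k \<le> n \<Longrightarrow> q ^ k \<noteq> 1" "q * \<zeta>\<^sup>2 = 1" "k \<le> n"
  shows "gauss_binomial q n k = (-1) ^ k * \<zeta> ^ (k * (k + 1))"
  using assms(4)
proof (induction k)
  case (Suc k)
  have q: "q ^ Suc k \<noteq> 1" "q ^ Suc k * q ^ (n - k) = 1"
    using assms(1,2) Suc.prems by (simp_all flip: power_add power_Suc)
  have \<zeta>: "q ^ Suc k * \<zeta> ^ (2 * Suc k) = 1"
    by (simp only: power_mult power_mult_distrib[symmetric] assms(3) power_one)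
  have "(1 - q ^ Suc k) * (q ^ Suc k * gauss_binomial q n (Suc k)) =
        q ^ Suc k * (1 - q ^ (n - k)) * gauss_binomial q n k"
    using gauss_binomial_ratio[of k n q] Suc.prems by (simp only: mult_ac Suc_leD)
  also have "q ^ Suc k * (1 - q ^ (n - k)) = (1 - q ^ Suc k) * (- 1)"
    using q(2) by (simp only: right_diff_distrib) simp
  finally have "q ^ Suc k * gauss_binomial q n (Suc k) = - gauss_binomial q n k"
    using q(1) by (simp only: mult.assoc mult_cancel_left) simp
  then have "gauss_binomial q n (Suc k) = - gauss_binomial q n k * \<zeta> ^ (2 * Suc k)"
    using \<zeta> by (metis mult.assoc mult.commute mult.left_neutral)
  also have "\<dots> = (-1) ^ Suc k * (\<zeta> ^ (k * (k + 1)) * \<zeta> ^ (2 * Suc k))"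
    using Suc by simp
  also have "\<zeta> ^ (k * (k + 1)) * \<zeta> ^ (2 * Suc k) = \<zeta> ^ (Suc k * (Suc k + 1))"
    unfolding power_add[symmetric] by (rule arg_cong[where f = "power \<zeta>"]) simp
  finally show ?case .
qed simp

text \<open>
  The angle \<open>2 \<pi> (2 j + 1) / (2 m + 1)\<close> lies below \<open>\<pi>\<close> for \<open>j < m - m div 2\<close> and between \<open>\<pi>\<close> and \<open>2 \<pi>\<close>
  for the other \<open>m div 2\<close> indices.
\<close>

lemma prod_sin_odd_multiples_sign:
  "(-1) ^ (m div 2) * (\<Prod>j<m. sin (2 * pi * real (2 * j + 1) / real (2 * m + 1))) > 0"
proof -
  define s :: "nat \<Rightarrow> real" where "s j = (if j < m - m div 2 then 1 else - 1)" for j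
  have "(\<Prod>j<m. s j) = (\<Prod>j<m - m div 2. s j) * (\<Prod>j\<in>{m - m div 2..<m}. s j)"
    using prod.atLeastLessThan_concat[of 0 "m - m div 2" m s] by (simp add: atLeast0LessThan)
  also have "\<dots> = (-1) ^ (m div 2)"
    by (simp add: s_def)
  finally have "(-1) ^ (m div 2) * (\<Prod>j<m. sin (2 * pi * real (2 * j + 1) / real (2 * m + 1))) =
      (\<Prod>j<m. s j * sin (2 * pi * real (2 * j + 1) / real (2 * m + 1)))"
    by (simp add: prod.distrib)
  also have "\<dots> > 0"
  proof (rule prod_pos)
    fix j assume "j \<in> {..<m}"
    then have j: "j < m" by simp
    let ?t = "2 * pi * real (2 * j + 1) / real (2 * m + 1)"
    show "s j * sin ?t > 0"
    proof (cases "j < m - m div 2")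
      case True
      then have "2 * (2 * j + 1) < 2 * m + 1" by presburger
      then have "2 * real (2 * j + 1) < real (2 * m + 1)" by linarith
      from mult_strict_left_mono[OF this pi_gt_zero] have "?t < pi" by (simp add: field_simps)
      moreover have "?t > 0" by simp
      ultimately show ?thesis using True sin_gt_zero by (simp add: s_def)
    next
      case False
      then have "2 * m + 1 < 2 * (2 * j + 1)" by presburger
      then have "real (2 * m + 1) < 2 * real (2 * j + 1)" by linarith
      from mult_strict_left_mono[OF this pi_gt_zero] have "pi < ?t" by (simp add: field_simps)
      moreover have "real (2 * j + 1) < real (2 * m + 1)" using j by simp
      from mult_strict_left_mono[OF this pi_gt_zero] have "?t < 2 * pi" by (simp add: field_simps)
      ultimately show ?thesis using False sin_lt_zero by (simp add: s_def)
    qed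
  qed
  finally show ?thesis .
qed

text \<open>
  Take \<open>q = e(-2)\<close> in Gauss's identity: the left-hand side becomes \<open>\<Sum>x. e(x (x + 1))\<close> and the factors
  on the right become \<open>1 - e(-2 k) = e(-k) (e(k) - e(-k))\<close> with \<open>k\<close> odd. Completing the square by
  the shift \<open>m + 1\<close>, which is one half modulo \<open>p\<close>, contributes the factor \<open>e(m\<^sup>2)\<close>; it is cancelled by
  the product of the \<open>e(-k)\<close>, as the first \<open>m\<close> odd numbers add up to \<open>m\<^sup>2\<close>.
\<close>

lemma quadratic_sum_eq_sine_product:
  assumes "prime p" "p = 2 * m + 1"
  shows "(\<Sum>x\<in>{0..<int p}. additive_character p (x\<^sup>2)) =
    (\<Prod>j<m. 2 * \<i> * of_real (sin (2 * pi * real (2 * j + 1) / real p)))"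
proof -
  let ?e = "additive_character p" and ?R = "{0..<int p}"
  have p: "p > 0" "p > 1" using assms(1) by (simp_all add: prime_gt_0_nat prime_gt_Suc_0_nat)
  have odd: "odd p" using assms(2) by simp
  define q where "q = ?e (-2)"
  have q_power: "q ^ k = ?e (-2 * int k)" for k
    by (simp only: q_def additive_character_mult_nat)
  have q_power_neq_1: "q ^ k \<noteq> 1" if "0 < k" "k \<le> 2 * m" for k
  proof
    assume "q ^ k = 1"
    then have "p dvd 2 * k"
      using p(1) unfolding q_power by (simp add: additive_character_eq_1_iff flip: int_dvd_int_iff)
    then have "p dvd k"
      using odd by (simp add: coprime_dvd_mult_right_iff)
    then show False using that assms(2) by (auto dest: dvd_imp_le)
  qed
  have q_p: "q ^ Suc (2 * m) = 1"
  proof -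
    have "Suc (2 * m) = p" using assms(2) by simp
    then show ?thesis
      by (simp only: q_power additive_character_eq_1_iff[OF p(1)] dvd_triv_right)
  qed
  have q_e: "q * (?e 1)\<^sup>2 = 1"
    using additive_character_mult_nat[of p 1 2] additive_character_add[of p "-2" 2] by (simp add: q_def)
  have "(\<Sum>x\<in>?R. ?e (x * (x + 1))) = (\<Sum>k\<le>2*m. ?e (int (k * (k + 1))))"
    by (rule sum.reindex_bij_witness[where i = int and j = nat]) (auto simp: assms(2) distrib_left add.commute)
  also have "\<dots> = (\<Sum>k\<le>2*m. (-1) ^ k * gauss_binomial q (2*m) k)"
  proof (rule sum.cong[OF refl])
    fix k assume "k \<in> {..2*m}"
    then have "gauss_binomial q (2*m) k = (-1) ^ k * ?e 1 ^ (k * (k + 1))"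
      by (intro gauss_binomial_root_of_unity q_p q_power_neq_1 q_e) auto
    also have "?e 1 ^ (k * (k + 1)) = ?e (int (k * (k + 1)))"
      using additive_character_mult_nat[of p 1 "k * (k + 1)"] by simp
    finally show "?e (int (k * (k + 1))) = (-1) ^ k * gauss_binomial q (2*m) k"
      by (simp flip: power_mult_distrib mult.assoc)
  qed
  also have "\<dots> = (\<Prod>j<m. 1 - ?e (-2 * int (2 * j + 1)))"
    by (simp only: alternating_sum_gauss_binomial q_power)
  also have "\<dots> = (\<Prod>j<m. ?e (- int (2 * j + 1)) *
      (2 * \<i> * of_real (sin (2 * pi * real (2 * j + 1) / real p))))"
  proof (rule prod.cong[OF refl])
    fix j
    let ?k = "int (2 * j + 1)"
    have "1 - ?e (-2 * ?k) = ?e (- ?k) * (?e ?k - ?e (- ?k))"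
      by (simp only: right_diff_distrib additive_character_add[symmetric]) simp
    also have "?e ?k - ?e (- ?k) = 2 * \<i> * of_real (sin (2 * pi * real (2 * j + 1) / real p))"
    proof -
      have "?e ?k = cis (2 * pi * real (2 * j + 1) / real p)"
        by (simp only: additive_character_def of_int_of_nat_eq)
      then show ?thesis
        by (simp only: additive_character_minus cis_inverse) (simp add: complex_eq_iff)
    qed
    finally show "1 - ?e (-2 * ?k) = ?e (- ?k) * (2 * \<i> * of_real (sin (2 * pi * real (2 * j + 1) / real p)))" .
  qed
  also have "\<dots> = (\<Prod>j<m. ?e (- int (2 * j + 1))) *
      (\<Prod>j<m. 2 * \<i> * of_real (sin (2 * pi * real (2 * j + 1) / real p)))"
    by (rule prod.distrib)
  also have "(\<Prod>j<m. ?e (- int (2 * j + 1))) = ?e (- (int m)\<^sup>2)"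
    by (induction m) (simp_all add: additive_character_add[symmetric] power2_eq_square algebra_simps)
  finally have shifted: "(\<Sum>x\<in>?R. ?e (x * (x + 1))) = ?e (- (int m)\<^sup>2) *
      (\<Prod>j<m. 2 * \<i> * of_real (sin (2 * pi * real (2 * j + 1) / real p)))" .
  have per: "periodic_mod p (\<lambda>x. ?e (x\<^sup>2))"
    by (intro periodic_mod_comp[OF periodic_mod_additive_character] cong_pow) simp
  have "(\<Sum>x\<in>?R. ?e (x\<^sup>2)) = (\<Sum>x\<in>?R. ?e ((1 * x + (int m + 1))\<^sup>2))"
    by (rule sum_residues_affine[OF p(1) per, symmetric]) simp
  also have "\<dots> = (\<Sum>x\<in>?R. ?e ((int m)\<^sup>2) * ?e (x * (x + 1)))"
  proof (rule sum.cong[OF refl])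
    fix x
    have "(1 * x + (int m + 1))\<^sup>2 - ((int m)\<^sup>2 + x * (x + 1)) = int p * (x + 1)"
      by (simp add: assms(2) power2_eq_square algebra_simps)
    then have "[(1 * x + (int m + 1))\<^sup>2 = (int m)\<^sup>2 + x * (x + 1)] (mod int p)"
      by (simp add: cong_iff_dvd_diff)
    from additive_character_cong[OF p(1) this]
    show "?e ((1 * x + (int m + 1))\<^sup>2) = ?e ((int m)\<^sup>2) * ?e (x * (x + 1))"
      by (simp only: additive_character_add)
  qed
  also have "\<dots> = ?e ((int m)\<^sup>2) * (\<Sum>x\<in>?R. ?e (x * (x + 1)))"
    by (rule sum_distrib_left[symmetric])
  also have "\<dots> = (\<Prod>j<m. 2 * \<i> * of_real (sin (2 * pi * real (2 * j + 1) / real p)))"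
    unfolding shifted by (simp add: additive_character_minus)
  finally show ?thesis .
qed

lemma gauss_sum_Legendre_eq_quadratic_sum:
  assumes "prime p" "p > 2"
  shows "gauss_sum p (\<lambda>x. of_int (Legendre x (int p))) =
    (\<Sum>x\<in>{0..<int p}. additive_character p (x\<^sup>2))"
proof -
  have p: "p > 0" "\<not> int p dvd 1" using assms(2) by auto
  have "(\<Sum>x\<in>{0..<int p}. additive_character p x) = 0"
    using sum_additive_character[OF p(1), of 1] p(2) by simp
  then show ?thesis
    unfolding sum_squares_Legendre[OF assms periodic_mod_additive_character]
    by (simp add: gauss_sum_def distrib_left sum.distrib mult.commute)
qed

text \<open>
  Otherwise every unit would have two square roots, which is impossible, as the \<open>p - 1\<close> units are the
  only candidates.
\<close>

lemma nontrivial_character_Legendre: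
  assumes "prime p" "p > 2"
  shows "nontrivial_character p (\<lambda>x. of_int (Legendre x (int p)))"
proof (rule ccontr)
  assume "\<not> ?thesis"
  then have "of_int (Legendre x (int p)) = (1::complex)" if "\<not> int p dvd x" for x
    using that by (auto simp: nontrivial_character_def)
  then have Legendre_1: "of_int (Legendre x (int p)) = (1::complex)" if "x \<in> {1..<int p}" for x
    using coprime_prime_residue(2)[OF assms(1) that] by simp
  have "periodic_mod p (\<lambda>x. 1)" by (simp add: periodic_mod_def)
  from sum_squares_Legendre[OF assms this] show False
    using assms(2) Legendre_1 residue_character_0[OF residue_character_Legendre[OF assms]]
    by (simp add: sum.distrib sum_residues_split_0 of_nat_diff)
qed

text \<open>
  The sine product shows that the sum is \<open>\<i>\<^sup>m\<close> times a real number \<open>R\<close> and gives the sign of \<open>R\<close>; the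
  modulus of \<open>R\<close> follows from \<open>g(\<eta>)\<^sup>2 = \<plusminus>p\<close>.
\<close>

theorem quadratic_gauss_sum:
  assumes "prime p" "p > 2"
  shows "gauss_sum p (\<lambda>x. of_int (Legendre x (int p))) = i_star p * of_real (sqrt (real p))"
proof -
  let ?g = "gauss_sum p (\<lambda>x. of_int (Legendre x (int p)))"
  define m where "m = p div 2"
  have m: "p = 2 * m + 1"
    using assms prime_odd_nat[of p] by (simp add: m_def)
  define R where "R = 2 ^ m * (\<Prod>j<m. sin (2 * pi * real (2 * j + 1) / real p))"
  have g: "?g = \<i> ^ m * of_real R"
    unfolding gauss_sum_Legendre_eq_quadratic_sum[OF assms] quadratic_sum_eq_sine_product[OF assms(1) m]
    by (simp add: R_def prod.distrib power_mult_distrib mult_ac)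
  note char = residue_character_Legendre[OF assms]
  have "of_int (Legendre x (int p)) * of_int (Legendre x (int p)) = (1::complex)"
    if "\<not> int p dvd x" for x
    using that by (simp add: Legendre_def cong_0_iff)
  from gauss_sum_mult_inverse_character[OF assms(1) char char nontrivial_character_Legendre[OF assms] this]
  have "?g * ?g = of_int (Legendre (-1) (int p)) * of_nat p" .
  then have "norm ?g * norm ?g = norm (complex_of_int (Legendre (-1) (int p))) * real p"
    by (simp flip: norm_mult) (simp add: norm_mult)
  also have "norm (complex_of_int (Legendre (-1) (int p))) = 1"
    using assms(2) by (simp add: Legendre_def cong_0_iff)
  also have "norm ?g = \<bar>R\<bar>"
    by (simp add: g norm_mult norm_power)
  finally have "R\<^sup>2 = real p"
    by (simp add: power2_eq_square)
  moreover have "(-1) ^ (m div 2) * R > 0"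
  proof -
    have "(-1) ^ (m div 2) * R = 2 ^ m * ((-1) ^ (m div 2) *
        (\<Prod>j<m. sin (2 * pi * real (2 * j + 1) / real (2 * m + 1))))"
      unfolding R_def m by (simp only: mult_ac)
    also have "\<dots> > 0"
      by (intro mult_pos_pos prod_sin_odd_multiples_sign) simp
    finally show ?thesis .
  qed
  ultimately have "(-1) ^ (m div 2) * R = sqrt (real p)"
    by (intro real_sqrt_unique[symmetric]) (simp_all add: power_mult_distrib flip: power_mult)
  then have "R = (-1) ^ (m div 2) * sqrt (real p)"
    by (simp flip: power_mult_distrib mult.assoc add: minus_one_power_iff split: if_splits)
  moreover have "\<i> ^ m * (-1) ^ (m div 2) = i_star p"
  proof (cases "even m")
    case True
    then obtain r where r: "m = 2 * r" ..
    then have "[p = 1] (mod 4)" using m by (simp add: cong_def)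
    then show ?thesis
      by (simp add: i_star_def r power_mult flip: power_mult_distrib)
  next
    case False
    then obtain r where r: "m = 2 * r + 1" by (rule oddE)
    then have "p = 4 * r + 3" using m by simp
    then have "\<not> [p = 1] (mod 4)" by (simp add: cong_def)
    then show ?thesis
      by (simp add: i_star_def r power_mult power_add flip: power_mult_distrib)
  qed
  ultimately show ?thesis
    unfolding g by (simp flip: mult.assoc)
qed

section \<open>Cubic sums in terms of Gauss sums\<close>

lemma exp_cube_eq_additive_character:
  "exp (\<i> * 2 * of_real pi * of_nat x ^ 3 / of_nat p) = additive_character p (int x ^ 3)"
  by (simp add: additive_character_def cis_conv_exp mult_ac)

lemma sum_nat_eq_sum_int: "(\<Sum>x<p. f (int x)) = (\<Sum>x\<in>{0..<int p}. f x)"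
  by (rule sum.reindex_bij_witness[where i = nat and j = int]) auto

locale cubic_character =
  fixes p :: nat and \<psi> :: "int \<Rightarrow> complex"
  assumes prime: "prime p" and p_gt_2: "p > 2"
    and cubic: "power_residue_character p 3 \<psi>"
begin

definition \<phi> :: "int \<Rightarrow> complex" where
  "\<phi> = (\<lambda>x. \<psi> x * \<psi> x)"

definition \<eta> :: "int \<Rightarrow> complex" where
  "\<eta> = (\<lambda>x. of_int (Legendre x (int p)))"

lemma p_gt: "p > 0" "p > 1"
  using p_gt_2 by simp_all

lemma character_\<psi>: "residue_character p \<psi>"
  using cubic by (rule power_residue_character_character)

lemma character_\<phi>: "residue_character p \<phi>"
  unfolding \<phi>_def by (rule residue_character_product[OF character_\<psi> character_\<psi>])

lemma character_\<eta>: "residue_character p \<eta>"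
  unfolding \<eta>_def by (rule residue_character_Legendre[OF prime p_gt_2])

lemma \<psi>_cube: "\<not> int p dvd x \<Longrightarrow> \<psi> x * (\<psi> x * \<psi> x) = 1"
  using power_residue_character_power[OF cubic] by (simp add: power3_eq_cube mult.assoc)

lemma \<phi>_square: "(\<lambda>x. \<phi> x * \<phi> x) = \<psi>"
proof
  fix x
  show "\<phi> x * \<phi> x = \<psi> x"
  proof (cases "int p dvd x")
    case True
    then show ?thesis
      using residue_character_eq_0_iff[OF character_\<psi>, of x] by (simp add: \<phi>_def)
  next
    case False
    then show ?thesis using \<psi>_cube[OF False] by (simp add: \<phi>_def mult.assoc)
  qed
qed

lemma \<eta>_square: "\<not> int p dvd x \<Longrightarrow> \<eta> x * \<eta> x = 1"
  by (simp add: \<eta>_def Legendre_def cong_0_iff)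

lemma \<eta>_cases: "\<not> int p dvd x \<Longrightarrow> \<eta> x = 1 \<or> \<eta> x = -1"
  using \<eta>_square[of x] by (simp add: square_eq_1_iff)

lemma sum_cubes:
  assumes "periodic_mod p f"
  shows "(\<Sum>x\<in>{0..<int p}. f (x ^ 3)) = f 0 + (\<Sum>x\<in>{1..<int p}. f x * (1 + \<psi> x + \<phi> x))"
proof -
  have "(\<Sum>i<3. \<psi> x ^ i) = 1 + \<psi> x + \<phi> x" for x
    by (simp add: \<phi>_def eval_nat_numeral)
  then show ?thesis
    using power_residue_character_power_sum[OF cubic assms] p_gt by (simp add: sum_residues_split_0)
qed

text \<open>
  If \<open>\<psi>\<close> were trivial, then every unit would have three cube roots among the \<open>p - 1\<close> units.
\<close>

lemma nontrivial_\<psi>: "nontrivial_character p \<psi>"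
proof (rule ccontr)
  assume "\<not> ?thesis"
  then have "\<psi> x = 1" if "x \<in> {1..<int p}" for x
    using coprime_prime_residue(2)[OF prime that] by (auto simp: nontrivial_character_def)
  moreover have "periodic_mod p (\<lambda>x. 1)" by (simp add: periodic_mod_def)
  ultimately show False
    using sum_cubes[of "\<lambda>x. 1"] p_gt p_gt_2 by (simp add: \<phi>_def of_nat_diff)
qed

text \<open>
  A value \<open>\<psi> c \<noteq> 1\<close> is a primitive cube root of unity. Neither it nor its square is \<open>\<plusminus>1\<close>, so
  multiplying by \<open>\<eta> c\<close> does not make them 1.
\<close>

lemma
  shows nontrivial_\<phi>: "nontrivial_character p \<phi>"
    and nontrivial_\<eta>\<psi>: "nontrivial_character p (\<lambda>x. \<eta> x * \<psi> x)"
    and nontrivial_\<eta>\<phi>: "nontrivial_character p (\<lambda>x. \<eta> x * \<phi> x)"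
proof -
  obtain c where c: "\<not> int p dvd c" "\<psi> c \<noteq> 1"
    using nontrivial_\<psi> by (auto simp: nontrivial_character_def)
  have \<phi>: "\<phi> c \<noteq> 1" "\<phi> c \<noteq> -1"
    using \<psi>_cube[OF c(1)] c(2) by (auto simp: \<phi>_def minus_equation_iff)
  have \<psi>: "\<psi> c \<noteq> -1"
    using \<psi>_cube[OF c(1)] by auto
  from c(1) \<phi>(1) show "nontrivial_character p \<phi>"
    by (auto simp: nontrivial_character_def)
  have "\<eta> c * \<psi> c \<noteq> 1" "\<eta> c * \<phi> c \<noteq> 1"
    using c(2) \<psi> \<phi> \<eta>_cases[OF c(1)] by (auto simp: minus_equation_iff)
  with c(1) show "nontrivial_character p (\<lambda>x. \<eta> x * \<psi> x)" "nontrivial_character p (\<lambda>x. \<eta> x * \<phi> x)"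
    by (auto simp: nontrivial_character_def)
qed

lemma cubic_gauss_sum_eq: "cubic_gauss_sum p = gauss_sum p \<psi> + gauss_sum p \<phi>"
proof -
  let ?e = "additive_character p" and ?R = "{0..<int p}"
  have "cubic_gauss_sum p = (\<Sum>x\<in>?R. ?e (x ^ 3))"
    unfolding cubic_gauss_sum_def exp_cube_eq_additive_character by (rule sum_nat_eq_sum_int)
  also have "\<dots> = (\<Sum>x\<in>?R. ?e x * (1 + \<psi> x + \<phi> x))"
    using sum_cubes[OF periodic_mod_additive_character] p_gt
    by (simp add: sum_residues_split_0 residue_character_0[OF character_\<psi>] residue_character_0[OF character_\<phi>])
  also have "\<dots> = (\<Sum>x\<in>?R. ?e x) + gauss_sum p \<psi> + gauss_sum p \<phi>"
    by (simp add: gauss_sum_def ring_distribs sum.distrib mult.commute)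
  also have "(\<Sum>x\<in>?R. ?e x) = 0"
    using sum_additive_character[OF p_gt(1), of 1] p_gt by simp
  finally show ?thesis by simp
qed

text \<open>
  The Legendre symbol is its own cube, so the summand is a function of \<open>x\<^sup>3\<close> here, too.
\<close>

lemma cubic_gauss_sum_Legendre_eq:
  "cubic_gauss_sum_Legendre p =
     gauss_sum p \<eta> + gauss_sum p (\<lambda>x. \<eta> x * \<psi> x) + gauss_sum p (\<lambda>x. \<eta> x * \<phi> x)"
proof -
  let ?e = "additive_character p" and ?R = "{0..<int p}"
  have "cubic_gauss_sum_Legendre p = (\<Sum>x\<in>?R. \<eta> x * ?e (x ^ 3))"
    unfolding cubic_gauss_sum_Legendre_def exp_cube_eq_additive_character \<eta>_def
    by (rule sum_nat_eq_sum_int)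
  also have "\<dots> = (\<Sum>x\<in>?R. \<eta> (x ^ 3) * ?e (x ^ 3))"
  proof (rule sum.cong[OF refl])
    fix x
    have "\<eta> (x ^ 3) = \<eta> x"
      unfolding residue_character_power[OF character_\<eta> p_gt(2)]
      using \<eta>_square[of x] residue_character_eq_0_iff[OF character_\<eta>, of x]
      by (cases "int p dvd x") (simp_all add: power3_eq_cube)
    then show "\<eta> x * ?e (x ^ 3) = \<eta> (x ^ 3) * ?e (x ^ 3)" by simp
  qed
  also have "\<dots> = (\<Sum>x\<in>?R. \<eta> x * ?e x * (1 + \<psi> x + \<phi> x))"
    using sum_cubes[OF periodic_mod_mult[OF residue_character_periodic[OF character_\<eta>]
          periodic_mod_additive_character]] p_gt
    by (simp add: sum_residues_split_0 residue_character_0[OF character_\<eta>])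
  also have "\<dots> = gauss_sum p \<eta> + gauss_sum p (\<lambda>x. \<eta> x * \<psi> x) + gauss_sum p (\<lambda>x. \<eta> x * \<phi> x)"
    by (simp add: gauss_sum_def ring_distribs sum.distrib mult_ac)
  finally show ?thesis .
qed

lemma gauss_sum_\<psi>_mult_\<phi>: "gauss_sum p \<psi> * gauss_sum p \<phi> = of_nat p"
proof -
  \<comment> \<open>\<open>\<psi> (-1)\<close> is a square root as well as a cube root of 1.\<close>
  have "\<psi> (-1) * \<psi> (-1) = 1"
    using residue_character_mult[OF character_\<psi>, of "-1" "-1"]
      residue_character_1[OF character_\<psi> p_gt(2)] by simp
  then have "\<psi> (-1) = 1"
    using \<psi>_cube[of "-1"] p_gt by simp
  then show ?thesis
    using gauss_sum_mult_inverse_character[OF prime character_\<psi> character_\<phi> nontrivial_\<psi>] \<psi>_cube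
    by (simp add: \<phi>_def)
qed

lemma not_dvd_2: "\<not> int p dvd 2"
  using p_gt_2 zdvd_not_zless[of 2 "int p"] by simp

lemma \<psi>_2_cube: "\<psi> 2 * \<psi> 2 * \<psi> 2 = 1"
  using \<psi>_cube[OF not_dvd_2] by (simp add: mult.assoc)

lemma cubic_residue_2_iff: "cubic_residue p 2 \<longleftrightarrow> \<psi> 2 = 1"
proof -
  have "coprime 2 (int p)"
    using not_dvd_2 prime prime_imp_coprime[of "int p" 2] by (simp add: coprime_commute)
  then show ?thesis
    using power_residue_character_eq_1_iff[OF prime _ cubic not_dvd_2] by (simp add: cubic_residue_def)
qed

text \<open>
  Duplication for \<open>\<psi>\<close> and for \<open>\<phi>\<close> evaluates the two mixed Gauss sums; the squares on the right arise
  from multiplying by \<open>B\<close> or \<open>A\<close> to replace a division by \<open>A\<close> or \<open>B\<close>, using \<open>A B = p\<close>.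
\<close>

lemma cubic_gauss_sum_Legendre_mult_p:
  defines "A \<equiv> gauss_sum p \<psi>" and "B \<equiv> gauss_sum p \<phi>" and "w \<equiv> \<psi> 2"
  shows "of_nat p * cubic_gauss_sum_Legendre p =
    gauss_sum p \<eta> * (of_nat p + w * B\<^sup>2 + w * w * A\<^sup>2)"
proof -
  define g where "g = gauss_sum p \<eta>"
  have AB: "A * B = of_nat p"
    unfolding A_def B_def by (rule gauss_sum_\<psi>_mult_\<phi>)
  then have nonzero: "A \<noteq> 0" "B \<noteq> 0"
    using p_gt by auto
  have w3: "w * w * w = 1"
    unfolding w_def by (rule \<psi>_2_cube)
  have \<psi>4: "\<psi> 4 = w * w"
    using residue_character_mult[OF character_\<psi>, of 2 2] by (simp add: w_def)
  have \<eta>\<psi>: "of_nat p * gauss_sum p (\<lambda>x. \<eta> x * \<psi> x) = w * g * B\<^sup>2"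
  proof -
    have "w * w * A * gauss_sum p (\<lambda>x. \<eta> x * \<psi> x) = g * B"
      using gauss_sum_duplication[OF prime p_gt_2 character_\<psi>] nontrivial_\<phi> nontrivial_\<eta>\<psi> nonzero
      by (simp add: \<psi>4 A_def B_def g_def \<phi>_def \<eta>_def)
    then have "(w * w * w) * (A * B) * gauss_sum p (\<lambda>x. \<eta> x * \<psi> x) = w * g * B\<^sup>2"
      by (simp add: power2_eq_square mult_ac)
    then show ?thesis by (simp add: w3 AB)
  qed
  have \<eta>\<phi>: "of_nat p * gauss_sum p (\<lambda>x. \<eta> x * \<phi> x) = w * w * g * A\<^sup>2"
  proof -
    have "\<phi> 4 = w"
      using w3 by (simp add: \<phi>_def \<psi>4 mult.assoc)
    then have "w * B * gauss_sum p (\<lambda>x. \<eta> x * \<phi> x) = g * A"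
      using gauss_sum_duplication[OF prime p_gt_2 character_\<phi>] nontrivial_\<psi> nontrivial_\<eta>\<phi> nonzero
      unfolding \<phi>_square by (simp add: A_def B_def g_def \<eta>_def)
    then have "(w * w * w) * (A * B) * gauss_sum p (\<lambda>x. \<eta> x * \<phi> x) = w * w * g * A\<^sup>2"
      by (simp add: power2_eq_square mult_ac)
    then show ?thesis by (simp add: w3 AB)
  qed
  show ?thesis
    unfolding cubic_gauss_sum_Legendre_eq distrib_left \<eta>\<psi> \<eta>\<phi> g_def[symmetric]
    by (simp add: algebra_simps)
qed

end

theorem theorem2:
  fixes p :: nat and S T :: complex
  assumes "prime p" and "[p = 1] (mod 6)"
  defines "S \<equiv> cubic_gauss_sum p"
    and "T \<equiv> cubic_gauss_sum_Legendre p"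
  shows "(cubic_residue p 2 \<longrightarrow>
            T = i_star p * (S\<^sup>2 - of_nat p) * of_real (real p powr (-1/2))) \<and>
         (\<not> cubic_residue p 2 \<longrightarrow>
            (\<exists>s\<in>{1, -1}. T = i_star p / 2
                * (4 * of_nat p - S\<^sup>2 + s * S * csqrt (12 * of_nat p - 3 * S\<^sup>2))
                * of_real (real p powr (-1/2))))"
proof -
  have p6: "p mod 6 = 1"
    using assms(2) by (simp add: cong_def)
  have p: "p > 0" "p > 1" using assms(1) prime_gt_1_nat[of p] by simp_all
  have "p \<noteq> 2" using p6 by auto
  then have p2: "p > 2" using p by simp
  have "3 dvd p - 1" using p6 by presburger
  then obtain \<psi> where \<psi>: "power_residue_character p 3 \<psi>"
    using power_residue_character_exists[OF assms(1), of 3] by auto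
  interpret cubic_character p \<psi>
    using assms(1) p2 \<psi> by unfold_locales
  define A where "A = gauss_sum p \<psi>"
  define B where "B = gauss_sum p \<phi>"
  define w where "w = \<psi> 2"
  have S_eq: "S = A + B"
    unfolding S_def A_def B_def by (rule cubic_gauss_sum_eq)
  have AB: "A * B = of_nat p"
    unfolding A_def B_def by (rule gauss_sum_\<psi>_mult_\<phi>)
  have w3: "w * w * w = 1"
    unfolding w_def by (rule \<psi>_2_cube)
  have pT: "of_nat p * T = gauss_sum p \<eta> * (of_nat p + w * B\<^sup>2 + w * w * A\<^sup>2)"
    unfolding T_def A_def B_def w_def by (rule cubic_gauss_sum_Legendre_mult_p)
  define r where "r = complex_of_real (real p powr (-1/2))"
  have r: "of_real (sqrt (real p)) = of_nat p * r"
  proof -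
    have "sqrt (real p) = real p * real p powr (-1/2)"
      using p powr_add[of "real p" 1 "-1/2"] by (simp add: powr_half_sqrt)
    then show ?thesis by (simp only: r_def of_real_mult of_real_of_nat_eq)
  qed
  have "gauss_sum p \<eta> = i_star p * (of_nat p * r)"
    unfolding \<eta>_def r[symmetric] by (rule quadratic_gauss_sum[OF assms(1) p2])
  then have T: "T = i_star p * r * (of_nat p + w * B\<^sup>2 + w * w * A\<^sup>2)"
    using pT p by simp
  show ?thesis
    unfolding cubic_residue_2_iff w_def[symmetric] r_def[symmetric]
  proof (intro conjI impI)
    assume "w = 1"
    then show "T = i_star p * (S\<^sup>2 - of_nat p) * r"
      unfolding T S_eq AB[symmetric] by (simp add: power2_eq_square algebra_simps)
  next
    assume "w \<noteq> 1"
    moreover have "(w - 1) * (1 + w + w * w) = 0"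
      using w3 by (simp add: algebra_simps)
    ultimately have "1 + w + w * w = 0"
      by (simp only: mult_eq_0_iff) simp
    moreover have "w * w = (1 + w + w * w) - 1 - w" by simp
    ultimately have w: "w * w = - 1 - w" by simp
    \<comment> \<open>\<open>w\<close> and \<open>w\<^sup>2\<close> are \<open>(-1 \<plusminus> (w - w\<^sup>2)) / 2\<close>; so \<open>2 (w B\<^sup>2 + w\<^sup>2 A\<^sup>2)\<close> is \<open>- (A\<^sup>2 + B\<^sup>2)\<close> plus
      \<open>(w - w\<^sup>2) (B\<^sup>2 - A\<^sup>2) = D S\<close>.\<close>
    define D where "D = (w - w * w) * (B - A)"
    have "D\<^sup>2 = (w * w - 2 * (w * w * w) + w * (w * w * w)) * ((A + B)\<^sup>2 - 4 * (A * B))"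
      by (simp add: D_def power2_eq_square algebra_simps)
    also have "\<dots> = 12 * of_nat p - 3 * S\<^sup>2"
      by (simp add: w3 w AB S_eq algebra_simps)
    finally have "D\<^sup>2 = (csqrt (12 * of_nat p - 3 * S\<^sup>2))\<^sup>2"
      by simp
    then obtain s where s: "s \<in> {1, -1}" "D = s * csqrt (12 * of_nat p - 3 * S\<^sup>2)"
      unfolding power2_eq_iff by force
    have double: "2 * (w * B\<^sup>2 + w * w * A\<^sup>2) = 2 * of_nat p - S\<^sup>2 + D * S"
      by (simp add: D_def S_eq AB[symmetric] w power2_eq_square algebra_simps)
    have "T = i_star p / 2 * (2 * of_nat p + 2 * (w * B\<^sup>2 + w * w * A\<^sup>2)) * r"
      unfolding T by (simp add: field_simps)
    also have "2 * of_nat p + 2 * (w * B\<^sup>2 + w * w * A\<^sup>2) = 4 * of_nat p - S\<^sup>2 + D * S"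
      unfolding double by simp
    also have "D * S = s * S * csqrt (12 * of_nat p - 3 * S\<^sup>2)"
      by (simp add: s(2))
    finally show "\<exists>s\<in>{1, -1}. T = i_star p / 2
                * (4 * of_nat p - S\<^sup>2 + s * S * csqrt (12 * of_nat p - 3 * S\<^sup>2)) * r"
      using s(1) by blast
  qed
qed

end
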